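(* Let $T$ be a rooted, countably infinite and locally finite tree and let $S$ be the forward shift on $\mathcal{L}_0$. Then $S$ is not hypercyclic.
   Context: A tree is an undirected graph (no loops or multiple edges) in which any two vertices are joined by exactly one path; $T$ also denotes its vertex set. It is locally finite if every vertex has finite degree. $T$ has a distinguished vertex $o$, the root; $|v|$ is the length (number of edges) of the path from $o$ to $v$. For $v\neq o$, the parent $\mathrm{par}(v)$ is the vertex preceding $v$ on the unique path from $o$ to $v$. For $f:T\to\mathbb{C}$ define $f'(o)=f(o)$ and $f'(v)=f(v)-f(\mathrm{par}(v))$ for $v\neq o$. The little Lipschitz space $\mathcal{L}_0$ is the Banach space of all $f:T\to\mathbb{C}$ with $\lim_{|v|\to\infty}f'(v)=0$, with norm $\|f\|=\sup_{v\in T}|f'(v)|$. The forward shift is $(Sf)(o)=0$, $(Sf)(v)=f(\mathrm{par}(v))$ for $v\ne o$; it is bounded on $\mathcal{L}_0$. A bounded operator $A$ on a Banach space $X$ is hypercyclic if there is $f\in X$ such that $\{f,Af,A^2f,\dots\}$ is dense in $X$. *)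

theory Defs
  imports "HOL-Analysis.Analysis"
begin

text \<open>The type \<open>'a\<close> is the vertex set; \<open>E u v\<close> says that \<open>u\<close> and \<open>v\<close> are joined by an edge.\<close>

definition is_path :: "('a \<Rightarrow> 'a \<Rightarrow> bool) \<Rightarrow> 'a \<Rightarrow> 'a list \<Rightarrow> 'a \<Rightarrow> bool"
  where "is_path E u p v \<longleftrightarrow>
    p \<noteq> [] \<and> hd p = u \<and> last p = v \<and> distinct p \<and> successively E p"

definition is_tree :: "('a \<Rightarrow> 'a \<Rightarrow> bool) \<Rightarrow> bool"
  where "is_tree E \<longleftrightarrow> symp E \<and> irreflp E \<and> (\<forall>u v. \<exists>!p. is_path E u p v)"

definition locally_finite :: "('a \<Rightarrow> 'a \<Rightarrow> bool) \<Rightarrow> bool"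
  where "locally_finite E \<longleftrightarrow> (\<forall>v. finite {w. E v w})"

definition the_path :: "('a \<Rightarrow> 'a \<Rightarrow> bool) \<Rightarrow> 'a \<Rightarrow> 'a \<Rightarrow> 'a list"
  where "the_path E u v = (THE p. is_path E u p v)"

text \<open>Paths are lists of vertices, so the number of edges is one less than the list length.\<close>

definition vlength :: "('a \<Rightarrow> 'a \<Rightarrow> bool) \<Rightarrow> 'a \<Rightarrow> 'a \<Rightarrow> nat"
  where "vlength E r v = length (the_path E r v) - 1"

text \<open>Meaningful for \<open>v \<noteq> r\<close> only.\<close>

definition parent :: "('a \<Rightarrow> 'a \<Rightarrow> bool) \<Rightarrow> 'a \<Rightarrow> 'a \<Rightarrow> 'a"
  where "parent E r v = last (butlast (the_path E r v))"

definition tree_deriv :: "('a \<Rightarrow> 'a \<Rightarrow> bool) \<Rightarrow> 'a \<Rightarrow> ('a \<Rightarrow> complex) \<Rightarrow> 'a \<Rightarrow> complex"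
  where "tree_deriv E r f v = (if v = r then f r else f v - f (parent E r v))"

text \<open>The filter \<open>filtercomap (vlength E r) at_top\<close> expresses \<open>|v| \<rightarrow> \<infinity>\<close>.\<close>

definition little_lipschitz :: "('a \<Rightarrow> 'a \<Rightarrow> bool) \<Rightarrow> 'a \<Rightarrow> ('a \<Rightarrow> complex) set"
  where "little_lipschitz E r =
    {f. (tree_deriv E r f \<longlongrightarrow> 0) (filtercomap (vlength E r) at_top)}"

text \<open>On a locally finite tree the supremum below is over a bounded set for every function in
  the little Lipschitz space; see \<open>bdd_above_tree_deriv\<close>.\<close>

definition lipschitz_norm :: "('a \<Rightarrow> 'a \<Rightarrow> bool) \<Rightarrow> 'a \<Rightarrow> ('a \<Rightarrow> complex) \<Rightarrow> real"
  where "lipschitz_norm E r f = (SUP v. cmod (tree_deriv E r f v))"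

text \<open>The library's \<open>Metric_space\<close> demands nonnegativity and symmetry on the whole type,
  hence the value \<open>0\<close> outside the space, where the supremum is unspecified; the topology
  does not depend on it.\<close>

definition lipschitz_dist ::
    "('a \<Rightarrow> 'a \<Rightarrow> bool) \<Rightarrow> 'a \<Rightarrow> ('a \<Rightarrow> complex) \<Rightarrow> ('a \<Rightarrow> complex) \<Rightarrow> real"
  where "lipschitz_dist E r f g =
    (if f \<in> little_lipschitz E r \<and> g \<in> little_lipschitz E r
     then lipschitz_norm E r (\<lambda>v. f v - g v) else 0)"

definition forward_shift ::
    "('a \<Rightarrow> 'a \<Rightarrow> bool) \<Rightarrow> 'a \<Rightarrow> ('a \<Rightarrow> complex) \<Rightarrow> 'a \<Rightarrow> complex"
  where "forward_shift E r f v = (if v = r then 0 else f (parent E r v))"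

text \<open>Hypercyclicity of a self-map \<open>A\<close> of a space \<open>X\<close> whose norm induces the metric \<open>d\<close>.
  Boundedness of the operator is not part of the definition; for the forward shift it is
  proved at the end of this theory.\<close>

definition hypercyclic :: "'b set \<Rightarrow> ('b \<Rightarrow> 'b \<Rightarrow> real) \<Rightarrow> ('b \<Rightarrow> 'b) \<Rightarrow> bool"
  where "hypercyclic X d A \<longleftrightarrow>
    (\<exists>f\<in>X. Metric_space.mtopology X d closure_of (range (\<lambda>n. (A ^^ n) f)) = X)"


lemma the_path: "is_tree E \<Longrightarrow> is_path E u (the_path E u v) v"
  unfolding is_tree_def the_path_def by (metis (no_types, lifting) theI)

lemma the_path_eq: "is_tree E \<Longrightarrow> is_path E u p v \<Longrightarrow> the_path E u v = p"
  unfolding is_tree_def the_path_def by blast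

lemma the_path_refl: "is_tree E \<Longrightarrow> the_path E r r = [r]"
  by (rule the_path_eq) (auto simp: is_path_def)

lemma vlength_root: "is_tree E \<Longrightarrow> vlength E r r = 0"
  by (simp add: vlength_def the_path_refl)

lemma parent_props:
  assumes "is_tree E" "v \<noteq> r"
  shows "E (parent E r v) v" and "vlength E r v = Suc (vlength E r (parent E r v))"
proof -
  define p where "p = the_path E r v"
  have p: "is_path E r p v" using the_path[OF assms(1)] p_def by simp
  then obtain q where pq: "p = q @ [v]"
    unfolding is_path_def by (metis append_butlast_last_id)
  have q: "q \<noteq> []" using p pq assms(2) by (auto simp: is_path_def)
  have par: "parent E r v = last q" using pq by (simp add: parent_def flip: p_def)
  have "is_path E r q (last q)"
    using p pq q by (auto simp: is_path_def successively_append_iff)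
  hence "the_path E r (last q) = q" by (rule the_path_eq[OF assms(1)])
  thus "vlength E r v = Suc (vlength E r (parent E r v))"
    using pq q unfolding par by (simp add: vlength_def flip: p_def)
  show "E (parent E r v) v"
    using p pq q by (auto simp: is_path_def successively_append_iff par)
qed

lemma finite_vlength_ball:
  assumes "is_tree E" "locally_finite E"
  shows "finite {v. vlength E r v \<le> n}"
proof (induction n)
  case 0
  have "{v. vlength E r v \<le> 0} \<subseteq> {r}"
    using parent_props(2)[OF assms(1)] by fastforce
  then show ?case by (rule finite_subset) simp
next
  case (Suc n)
  have "v \<in> insert r (\<Union>u\<in>{v. vlength E r v \<le> n}. {w. E u w})" if "vlength E r v \<le> Suc n" for v
    using parent_props[OF assms(1), of v r] that by (cases "v = r") auto
  hence "{v. vlength E r v \<le> Suc n} \<subseteq> insert r (\<Union>u\<in>{v. vlength E r v \<le> n}. {w. E u w})"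
    by blast
  moreover have "finite (insert r (\<Union>u\<in>{v. vlength E r v \<le> n}. {w. E u w}))"
    using Suc assms(2) by (auto simp: locally_finite_def)
  ultimately show ?case by (rule finite_subset)
qed

lemma little_lipschitz_iff:
  "f \<in> little_lipschitz E r \<longleftrightarrow>
    (\<forall>e>0. \<exists>N. \<forall>v. vlength E r v \<ge> N \<longrightarrow> cmod (tree_deriv E r f v) < e)"
  unfolding little_lipschitz_def tendsto_iff eventually_filtercomap_at_top_linorder
  by (simp add: dist_norm)

lemma bdd_above_tree_deriv:
  assumes "is_tree E" "locally_finite E" "f \<in> little_lipschitz E r"
  shows "bdd_above (range (\<lambda>v. cmod (tree_deriv E r f v)))"
proof -
  obtain N where N: "\<And>v. vlength E r v \<ge> N \<Longrightarrow> cmod (tree_deriv E r f v) < 1"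
    using assms(3) zero_less_one unfolding little_lipschitz_iff by blast
  have "range (\<lambda>v. cmod (tree_deriv E r f v)) \<subseteq>
      (\<lambda>v. cmod (tree_deriv E r f v)) ` {v. vlength E r v \<le> N} \<union> {..1}"
  proof (rule image_subsetI)
    fix v
    show "cmod (tree_deriv E r f v) \<in>
        (\<lambda>v. cmod (tree_deriv E r f v)) ` {v. vlength E r v \<le> N} \<union> {..1}"
      using N[of v] by (cases "vlength E r v \<le> N") auto
  qed
  moreover have "bdd_above ((\<lambda>v. cmod (tree_deriv E r f v)) ` {v. vlength E r v \<le> N} \<union> {..1})"
    using finite_vlength_ball[OF assms(1,2)] by (simp add: bdd_above_Un)
  ultimately show ?thesis by (rule bdd_above_mono[rotated])
qed

lemma tree_deriv_diff:
  "tree_deriv E r (\<lambda>v. f v - g v) v = tree_deriv E r f v - tree_deriv E r g v"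
  by (simp add: tree_deriv_def)

lemma little_lipschitz_diff:
  "f \<in> little_lipschitz E r \<Longrightarrow> g \<in> little_lipschitz E r \<Longrightarrow> (\<lambda>v. f v - g v) \<in> little_lipschitz E r"
  unfolding little_lipschitz_def by (auto simp: tree_deriv_diff[abs_def] intro: tendsto_eq_intros)

lemma tree_deriv_le_norm:
  assumes "is_tree E" "locally_finite E" "f \<in> little_lipschitz E r"
  shows "cmod (tree_deriv E r f v) \<le> lipschitz_norm E r f"
  unfolding lipschitz_norm_def by (rule cSUP_upper[OF _ bdd_above_tree_deriv[OF assms]]) simp

lemma tree_deriv_eq_0D:
  assumes "is_tree E" "\<And>v. tree_deriv E r f v = 0"
  shows "f v = 0"
proof (induction "vlength E r v" arbitrary: v rule: less_induct)
  case less
  show ?case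
    using less parent_props(2)[OF assms(1), of v r] assms(2)[of v]
    by (cases "v = r") (auto simp: tree_deriv_def)
qed

lemma Metric_space_little_lipschitz:
  assumes "is_tree E" "locally_finite E"
  shows "Metric_space (little_lipschitz E r) (lipschitz_dist E r)"
proof
  note le = tree_deriv_le_norm[OF assms]
  show "0 \<le> lipschitz_dist E r f g" for f g :: "'a \<Rightarrow> complex"
    using order_trans[OF norm_ge_zero le[OF little_lipschitz_diff], of f r g]
    by (simp add: lipschitz_dist_def)
  show "lipschitz_dist E r f g = lipschitz_dist E r g f" for f g :: "'a \<Rightarrow> complex"
    unfolding lipschitz_dist_def lipschitz_norm_def tree_deriv_diff
    by (simp add: norm_minus_commute)
  show "lipschitz_dist E r f g = 0 \<longleftrightarrow> f = g"
    if fg: "f \<in> little_lipschitz E r" "g \<in> little_lipschitz E r" for f g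
  proof
    assume "lipschitz_dist E r f g = 0"
    hence "tree_deriv E r (\<lambda>v. f v - g v) v = 0" for v
      using le[OF little_lipschitz_diff[OF fg], of v] by (simp add: lipschitz_dist_def fg)
    from tree_deriv_eq_0D[OF assms(1) this] show "f = g" by auto
  next
    have "tree_deriv E r (\<lambda>v. 0) v = 0" for v
      by (simp add: tree_deriv_def)
    thus "lipschitz_dist E r f g = 0" if "f = g"
      using that by (simp add: lipschitz_dist_def lipschitz_norm_def)
  qed
  show "lipschitz_dist E r f h \<le> lipschitz_dist E r f g + lipschitz_dist E r g h"
    if fg: "f \<in> little_lipschitz E r" "g \<in> little_lipschitz E r" "h \<in> little_lipschitz E r"
    for f g h
  proof -
    have "lipschitz_norm E r (\<lambda>v. f v - h v) \<le>
        lipschitz_norm E r (\<lambda>v. f v - g v) + lipschitz_norm E r (\<lambda>v. g v - h v)"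
      unfolding lipschitz_norm_def[of E r "\<lambda>v. f v - h v"]
    proof (rule cSUP_least)
      fix v
      have "cmod (tree_deriv E r (\<lambda>v. f v - h v) v) \<le>
          cmod (tree_deriv E r (\<lambda>v. f v - g v) v) + cmod (tree_deriv E r (\<lambda>v. g v - h v) v)"
        unfolding tree_deriv_diff
        by (rule norm_diff_triangle_le[OF order_refl order_refl])
      also have "\<dots> \<le> lipschitz_norm E r (\<lambda>v. f v - g v) + lipschitz_norm E r (\<lambda>v. g v - h v)"
        by (intro add_mono le little_lipschitz_diff fg)
      finally show "cmod (tree_deriv E r (\<lambda>v. f v - h v) v) \<le>
          lipschitz_norm E r (\<lambda>v. f v - g v) + lipschitz_norm E r (\<lambda>v. g v - h v)" .
    qed simp
    thus ?thesis by (simp add: lipschitz_dist_def fg)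
  qed
qed

lemma tree_deriv_forward_shift:
  "tree_deriv E r (forward_shift E r f) v =
    (if v = r then 0 else tree_deriv E r f (parent E r v))"
  by (auto simp: tree_deriv_def forward_shift_def)

lemma forward_shift_in_little_lipschitz:
  assumes "is_tree E" "f \<in> little_lipschitz E r"
  shows "forward_shift E r f \<in> little_lipschitz E r"
  unfolding little_lipschitz_iff
proof (intro allI impI)
  fix e :: real assume "e > 0"
  then obtain N where N: "\<And>v. vlength E r v \<ge> N \<Longrightarrow> cmod (tree_deriv E r f v) < e"
    using assms(2) unfolding little_lipschitz_iff by blast
  have "cmod (tree_deriv E r (forward_shift E r f) v) < e" if "vlength E r v \<ge> Suc N" for v
    using N[of "parent E r v"] parent_props(2)[OF assms(1), of v r] that \<open>e > 0\<close>
    by (auto simp: tree_deriv_forward_shift)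
  thus "\<exists>N. \<forall>v. N \<le> vlength E r v \<longrightarrow> cmod (tree_deriv E r (forward_shift E r f) v) < e"
    by blast
qed

lemma forward_shift_linear:
  "forward_shift E r (\<lambda>v. a * f v + b * g v) =
    (\<lambda>v. a * forward_shift E r f v + b * forward_shift E r g v)"
  by (auto simp: forward_shift_def)

lemma lipschitz_norm_forward_shift_le:
  assumes "is_tree E" "locally_finite E" "f \<in> little_lipschitz E r"
  shows "lipschitz_norm E r (forward_shift E r f) \<le> lipschitz_norm E r f"
  unfolding lipschitz_norm_def[of E r "forward_shift E r f"]
proof (rule cSUP_least)
  show "cmod (tree_deriv E r (forward_shift E r f) v) \<le> lipschitz_norm E r f" for v
    using tree_deriv_le_norm[OF assms, of "parent E r v"] tree_deriv_le_norm[OF assms, of r]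
    by (auto simp: tree_deriv_forward_shift intro: order_trans[OF norm_ge_zero])
qed simp

end

theory Submission
  imports Defs
begin

text \<open>
  Every function in the range of the shift vanishes at the root, and evaluation at the root is
  a contraction from the space to the complex numbers, since \<open>f'(o) = f(o)\<close>. Hence the values
  at the root along the orbit of \<open>f\<close> are only \<open>f(o), 0, 0, \<dots>\<close>: at most two numbers, which cannot be
  dense in \<open>\<complex>\<close>. As constants belong to the space, some constant function has distance at least
  \<open>1\<close> from the whole orbit.
\<close>

lemma const_in_little_lipschitz:
  assumes "is_tree E"
  shows "(\<lambda>v. c) \<in> little_lipschitz E r"
  unfolding little_lipschitz_iff
proof (intro allI impI)
  fix e :: real assume "e > 0"
  \<comment> \<open>The constant has derivative \<open>c\<close> at the root, the only vertex of length \<open>0\<close>.\<close>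
  have "\<forall>v. 1 \<le> vlength E r v \<longrightarrow> cmod (tree_deriv E r (\<lambda>v. c) v) < e"
    using vlength_root[OF assms, of r] \<open>e > 0\<close> by (auto simp: tree_deriv_def)
  thus "\<exists>N. \<forall>v. N \<le> vlength E r v \<longrightarrow> cmod (tree_deriv E r (\<lambda>v. c) v) < e" ..
qed

lemma norm_diff_root_le_lipschitz_dist:
  assumes "is_tree E" "locally_finite E" "f \<in> little_lipschitz E r" "g \<in> little_lipschitz E r"
  shows "cmod (f r - g r) \<le> lipschitz_dist E r f g"
  using tree_deriv_le_norm[OF assms(1,2) little_lipschitz_diff[OF assms(3,4)], of r] assms(3,4)
  by (simp add: lipschitz_dist_def tree_deriv_def)

lemma forward_shift_power_root:
  "(forward_shift E r ^^ n) f r = (if n = 0 then f r else 0)"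
  by (cases n) (auto simp: forward_shift_def)

theorem theorem7p1:
  fixes E :: "'a \<Rightarrow> 'a \<Rightarrow> bool" and root :: 'a
  assumes "is_tree E"
    and "countable (UNIV :: 'a set)" and "infinite (UNIV :: 'a set)"
    and "locally_finite E"
  shows "\<not> hypercyclic (little_lipschitz E root) (lipschitz_dist E root) (forward_shift E root)"
proof
  assume "hypercyclic (little_lipschitz E root) (lipschitz_dist E root) (forward_shift E root)"
  then obtain f where dense: "Metric_space.mtopology (little_lipschitz E root)
      (lipschitz_dist E root) closure_of (range (\<lambda>n. (forward_shift E root ^^ n) f))
      = little_lipschitz E root"
    unfolding hypercyclic_def by blast
  interpret Metric_space "little_lipschitz E root" "lipschitz_dist E root"
    by (rule Metric_space_little_lipschitz[OF assms(1,4)])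
  \<comment> \<open>A number at distance at least \<open>1\<close> from both \<open>0\<close> and \<open>f root\<close>.\<close>
  define c :: complex where "c = of_real (1 + cmod (f root))"
  have "cmod c = 1 + cmod (f root)"
    unfolding c_def norm_of_real by simp
  hence c: "1 \<le> cmod c" "1 \<le> cmod (c - f root)"
    using norm_triangle_ineq2[of c "f root"] by simp_all
  have "(\<lambda>v. c) \<in> mtopology closure_of (range (\<lambda>n. (forward_shift E root ^^ n) f))"
    using const_in_little_lipschitz[OF assms(1)] dense by simp
  then obtain n where
    n: "(forward_shift E root ^^ n) f \<in> little_lipschitz E root"
       "lipschitz_dist E root (\<lambda>v. c) ((forward_shift E root ^^ n) f) < 1"
    unfolding metric_closure_of mball_def by (auto dest!: spec[of _ 1])
  have "cmod (c - (forward_shift E root ^^ n) f root) < 1"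
    using norm_diff_root_le_lipschitz_dist[OF assms(1,4) const_in_little_lipschitz[OF assms(1)] n(1)]
      n(2) by (rule le_less_trans)
  thus False
    using c by (simp add: forward_shift_power_root split: if_splits)
qed

end
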